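(* Let $X$ be a Banach space, let $\mathfrak A\subseteq L(X)$ be a norm closed algebra of operators on $X$, and let $Y$ be a half-space in $X$. Then $Y$ is almost invariant under every operator in $\mathfrak A$ if and only if $Y$ is almost invariant under every operator in $\overline{\mathfrak A}^{WOT}$.
   Context: $L(X)$ denotes the algebra of bounded linear operators on $X$, and $\overline{\mathfrak A}^{WOT}$ denotes the closure of $\mathfrak A$ in $L(X)$ in the weak operator topology. A half-space of $X$ is a norm closed linear subspace of $X$ of infinite dimension and infinite codimension. A closed subspace $Y$ is almost invariant under $T\in L(X)$ if there is a finite-dimensional subspace $F\subseteq X$ (depending on $T$) with $TY\subseteq Y+F$. *)

theory Defs
  imports "HOL-Analysis.Analysis"
begin

text \<open>
  Banach spaces over the scalar field \<open>'k\<close>, real or complex. Both \<^typ>\<open>real\<close> and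
  \<^typ>\<open>complex\<close> have the sort \<open>{real_normed_field, euclidean_space}\<close>; conversely, by the
  Frobenius theorem, a type of this sort is isometrically isomorphic to one of the two (it is a
  commutative finite-dimensional real division algebra with a multiplicative norm).
  Type class \<open>banach\<close> knows only about real scalars, so scalar multiplication by \<open>'k\<close> is an
  explicit parameter \<open>s\<close> that extends the real one.
\<close>

locale banach_space = vector_space s
  for s :: "'k::{real_normed_field, euclidean_space} \<Rightarrow> 'a::banach \<Rightarrow> 'a" +
  assumes scale_of_real: "s (of_real r) x = r *\<^sub>R x"
    and norm_scale: "norm (s c x) = norm c * norm x"

lemma banach_space_real: "banach_space (scaleR :: real \<Rightarrow> 'a::banach \<Rightarrow> 'a)"
  by unfold_locales (simp_all add: algebra_simps)

lemma banach_space_complex: "banach_space ((*) :: complex \<Rightarrow> complex \<Rightarrow> complex)"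
  by unfold_locales (simp_all add: algebra_simps norm_mult scaleR_conv_of_real)

text \<open>
  \<^typ>\<open>'a \<Rightarrow>\<^sub>L 'b\<close> consists of the bounded real-linear maps, with the operator norm; the
  \<open>'k\<close>-linear ones have to be selected.
\<close>

definition bounded_operators ::
  "('k::{real_normed_field, euclidean_space} \<Rightarrow> 'a::banach \<Rightarrow> 'a) \<Rightarrow> ('a \<Rightarrow>\<^sub>L 'a) set" where
  "bounded_operators s =
     {T. \<forall>c x. blinfun_apply T (s c x) = s c (blinfun_apply T x)}"

definition dual_space ::
  "('k::{real_normed_field, euclidean_space} \<Rightarrow> 'a::banach \<Rightarrow> 'a) \<Rightarrow> ('a \<Rightarrow>\<^sub>L 'k) set" where
  "dual_space s = {f. \<forall>c x. blinfun_apply f (s c x) = c * blinfun_apply f x}"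

definition scale_operator ::
  "('k::{real_normed_field, euclidean_space} \<Rightarrow> 'a::banach \<Rightarrow> 'a) \<Rightarrow> 'k \<Rightarrow> ('a \<Rightarrow>\<^sub>L 'a) \<Rightarrow> ('a \<Rightarrow>\<^sub>L 'a)"
  where "scale_operator s c T = Blinfun (\<lambda>x. s c (blinfun_apply T x))"

lemma (in banach_space) scale_operator_apply:
  "blinfun_apply (scale_operator s c T) x = s c (blinfun_apply T x)"
proof -
  have "bounded_linear (\<lambda>x. s c (blinfun_apply T x))"
  proof (rule bounded_linear_intro)
    show "s c (blinfun_apply T (x + y)) = s c (blinfun_apply T x) + s c (blinfun_apply T y)" for x y
      by (simp add: blinfun.add_right scale_right_distrib)
    show "s c (blinfun_apply T (r *\<^sub>R x)) = r *\<^sub>R s c (blinfun_apply T x)" for r x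
      unfolding blinfun.scaleR_right by (simp add: scale_of_real[symmetric] mult.commute)
    show "norm (s c (blinfun_apply T x)) \<le> norm x * (norm c * norm T)" for x
      using mult_left_mono[OF norm_blinfun[of T x] norm_ge_zero[of c]]
      by (simp add: norm_scale mult_ac)
  qed
  then show ?thesis
    by (simp add: scale_operator_def bounded_linear_Blinfun_apply)
qed

text \<open>An algebra of operators need not contain the identity.\<close>

definition operator_algebra ::
  "('k::{real_normed_field, euclidean_space} \<Rightarrow> 'a::banach \<Rightarrow> 'a) \<Rightarrow> ('a \<Rightarrow>\<^sub>L 'a) set \<Rightarrow> bool" where
  "operator_algebra s A \<longleftrightarrow>
     A \<subseteq> bounded_operators s \<and> 0 \<in> A \<and>
     (\<forall>S\<in>A. \<forall>T\<in>A. S + T \<in> A) \<and>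
     (\<forall>c. \<forall>T\<in>A. scale_operator s c T \<in> A) \<and>
     (\<forall>S\<in>A. \<forall>T\<in>A. S o\<^sub>L T \<in> A)"

text \<open>The coarsest topology on the bounded operators for which every \<open>T \<mapsto> f (T x)\<close> is continuous.\<close>

definition weak_operator_topology ::
  "('k::{real_normed_field, euclidean_space} \<Rightarrow> 'a::banach \<Rightarrow> 'a) \<Rightarrow> ('a \<Rightarrow>\<^sub>L 'a) topology" where
  "weak_operator_topology s = topology_generated_by
     {{T \<in> bounded_operators s. blinfun_apply f (blinfun_apply T x) \<in> U} | f x U.
        f \<in> dual_space s \<and> open U}"

lemma topspace_weak_operator_topology:
  "topspace (weak_operator_topology s) = bounded_operators s"
proof -
  have "0 \<in> dual_space s"
    by (simp add: dual_space_def)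
  then have "bounded_operators s \<in>
      {{T \<in> bounded_operators s. blinfun_apply f (blinfun_apply T x) \<in> U} | f x U.
        f \<in> dual_space s \<and> open U}"
    by (intro CollectI exI[of _ 0] exI[of _ UNIV]) auto
  then show ?thesis
    unfolding weak_operator_topology_def topology_generated_by_topspace by blast
qed

definition finite_dimensional ::
  "('k::{real_normed_field, euclidean_space} \<Rightarrow> 'a::banach \<Rightarrow> 'a) \<Rightarrow> 'a set \<Rightarrow> bool" where
  "finite_dimensional s V \<longleftrightarrow> (\<exists>B. finite B \<and> B \<subseteq> V \<and> module.span s B = V)"

text \<open>The cosets of finitely many vectors span the quotient of the whole space by \<open>Y\<close>.\<close>

definition finite_codimensional ::
  "('k::{real_normed_field, euclidean_space} \<Rightarrow> 'a::banach \<Rightarrow> 'a) \<Rightarrow> 'a set \<Rightarrow> bool" where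
  "finite_codimensional s Y \<longleftrightarrow>
     (\<exists>B. finite B \<and> (\<forall>x. \<exists>b\<in>module.span s B. x - b \<in> Y))"

definition half_space ::
  "('k::{real_normed_field, euclidean_space} \<Rightarrow> 'a::banach \<Rightarrow> 'a) \<Rightarrow> 'a set \<Rightarrow> bool" where
  "half_space s Y \<longleftrightarrow>
     closed Y \<and> module.subspace s Y \<and>
     \<not> finite_dimensional s Y \<and> \<not> finite_codimensional s Y"

definition almost_invariant ::
  "('k::{real_normed_field, euclidean_space} \<Rightarrow> 'a::banach \<Rightarrow> 'a) \<Rightarrow> 'a set \<Rightarrow> ('a \<Rightarrow>\<^sub>L 'a) \<Rightarrow> bool" where
  "almost_invariant s Y T \<longleftrightarrow>
     (\<exists>F. module.subspace s F \<and> finite_dimensional s F \<and>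
          blinfun_apply T ` Y \<subseteq> {y + f | y f. y \<in> Y \<and> f \<in> F})"

end

theory Submission
  imports Defs
begin

text \<open>
  If every operator in the norm closed space \<open>A\<close> leaves \<open>Y\<close> invariant up to finite dimension, Baire's
  theorem yields one bound \<open>N\<close> for the dimension of \<open>(Y + T Y) / Y\<close> over all \<open>T \<in> A\<close>: some set of
  operators of defect at most \<open>n\<close> has interior in \<open>A\<close>, and the defect is subadditive and invariant
  under nonzero scaling. The condition "defect at most \<open>N\<close>" survives weak operator limits: if
  \<open>T y\<^sub>0, \<dots>, T y\<^sub>N\<close> are independent modulo \<open>Y\<close>, Hahn--Banach gives functionals \<open>f\<^sub>0, \<dots>, f\<^sub>N\<close>
  vanishing on \<open>Y\<close> and dual to them, and for \<open>S\<close> near \<open>T\<close> the matrix \<open>f\<^sub>j (S y\<^sub>i)\<close> remains regular.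
\<close>

section \<open>Sublinear functionals and the Hahn--Banach theorem\<close>

definition sublinear :: "('a::real_vector \<Rightarrow> real) \<Rightarrow> bool" where
  "sublinear p \<longleftrightarrow>
     (\<forall>x y. p (x + y) \<le> p x + p y) \<and> (\<forall>r x. 0 \<le> r \<longrightarrow> p (r *\<^sub>R x) = r * p x)"

lemma sublinear_add: "sublinear p \<Longrightarrow> p (x + y) \<le> p x + p y"
  and sublinear_scaleR: "sublinear p \<Longrightarrow> 0 \<le> r \<Longrightarrow> p (r *\<^sub>R x) = r * p x"
  by (auto simp: sublinear_def)

lemma sublinear_0: "sublinear p \<Longrightarrow> p 0 = 0"
  using sublinear_scaleR[of p 0 0] by simp

lemma sublinear_uminus_le: "sublinear p \<Longrightarrow> - p (- x) \<le> p x"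
  using sublinear_add[of p x "- x"] sublinear_0[of p] by simp

text \<open>Applying \<open>scale\<close> to \<open>inverse r\<close> and
  \<open>r *\<^sub>R x\<close> gives the reverse inequality; for \<open>r = 0\<close>, subadditivity
  at \<open>0\<close> yields \<open>0 \<le> p 0\<close>.\<close>

lemma sublinearI:
  assumes add: "\<And>x y. p (x + y) \<le> p x + p y"
    and scale: "\<And>r x. 0 < r \<Longrightarrow> p (r *\<^sub>R x) \<le> r * p x"
    and zero: "p 0 \<le> 0"
  shows "sublinear p"
  unfolding sublinear_def
proof (intro conjI allI impI)
  fix r :: real and x assume "0 \<le> r"
  show "p (r *\<^sub>R x) = r * p x"
  proof (cases "r = 0")
    case True
    then show ?thesis
      using add[of 0 0] zero by simp
  next
    case False
    with \<open>0 \<le> r\<close> have r: "0 < r" by simp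
    have "p x \<le> inverse r * p (r *\<^sub>R x)"
      using scale[of "inverse r" "r *\<^sub>R x"] r by simp
    then have "r * p x \<le> p (r *\<^sub>R x)"
      using r by (simp add: field_simps)
    with scale[OF r, of x] show ?thesis by simp
  qed
qed (rule add)

text \<open>This is the descent step for minimality: if nothing sublinear lies strictly below
  \<open>p\<close>, then \<open>q = p\<close> and hence \<open>p (- x) \<le> - p x\<close>. In the
  infimum defining \<open>q\<close>, the choice \<open>t = 0\<close> gives \<open>q \<le> p\<close>,
  and \<open>t = 1\<close> gives the bound at \<open>- x\<close>.\<close>

lemma sublinear_tilt:
  assumes p: "sublinear p"
  obtains q where "sublinear q" "q \<le> p" "q (- x) \<le> - p x"
proof
  define q where "q = (\<lambda>y. INF t\<in>{0..}. p (y + t *\<^sub>R x) - t * p x)"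
  \<comment> \<open>Subadditivity for \<open>t *\<^sub>R x = (y + t *\<^sub>R x) + (- y)\<close>
    keeps the infimum finite.\<close>
  have low: "- p (- y) \<le> p (y + t *\<^sub>R x) - t * p x" if "0 \<le> t" for y t
    using sublinear_add[OF p, of "y + t *\<^sub>R x" "- y"] sublinear_scaleR[OF p that, of x] by simp
  have bdd: "bdd_below ((\<lambda>t. p (y + t *\<^sub>R x) - t * p x) ` {0..})" for y
    by (rule bdd_belowI[of _ "- p (- y)"]) (use low in auto)
  have le: "q y \<le> p (y + t *\<^sub>R x) - t * p x" if "0 \<le> t" for y t
    unfolding q_def by (rule cINF_lower[OF bdd]) (use that in auto)
  have ge: "c \<le> q y" if "\<And>t. 0 \<le> t \<Longrightarrow> c \<le> p (y + t *\<^sub>R x) - t * p x" for c y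
    unfolding q_def by (rule cINF_greatest) (use that in auto)
  show "sublinear q"
  proof (rule sublinearI)
    fix y z
    \<comment> \<open>Parameters \<open>t\<close> for \<open>y\<close> and \<open>u\<close> for
      \<open>z\<close> combine to the parameter \<open>t + u\<close> for
      \<open>y + z\<close>.\<close>
    have "q (y + z) - (p (y + t *\<^sub>R x) - t * p x) \<le> q z" if t: "0 \<le> t" for t
    proof (rule ge)
      fix u :: real assume u: "0 \<le> u"
      show "q (y + z) - (p (y + t *\<^sub>R x) - t * p x) \<le> p (z + u *\<^sub>R x) - u * p x"
        using le[of "t + u" "y + z"] t u
          sublinear_add[OF p, of "y + t *\<^sub>R x" "z + u *\<^sub>R x"]
        by (simp add: algebra_simps)
    qed
    then have "q (y + z) - q z \<le> q y"
      by (intro ge) (simp add: algebra_simps)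
    then show "q (y + z) \<le> q y + q z" by simp
  next
    fix r :: real and y assume r: "0 < r"
    have "q (r *\<^sub>R y) / r \<le> q y"
    proof (rule ge)
      fix t :: real assume t: "0 \<le> t"
      have "q (r *\<^sub>R y) \<le> p (r *\<^sub>R (y + t *\<^sub>R x)) - r * t * p x"
        using le[of "r * t" "r *\<^sub>R y"] r t by (simp add: scaleR_add_right)
      also have "\<dots> = r * (p (y + t *\<^sub>R x) - t * p x)"
        using sublinear_scaleR[OF p, of r] r by (simp add: right_diff_distrib)
      finally show "q (r *\<^sub>R y) / r \<le> p (y + t *\<^sub>R x) - t * p x"
        using r by (simp add: field_simps)
    qed
    then show "q (r *\<^sub>R y) \<le> r * q y"
      using r by (simp add: field_simps)
  next
    show "q 0 \<le> 0"
      using le[of 0 0] sublinear_0[OF p] by simp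
  qed
  show "q \<le> p"
    using le[of 0] by (simp add: le_fun_def)
  show "q (- x) \<le> - p x"
    using le[of 1 "- x"] sublinear_0[OF p] by simp
qed

text \<open>Supplies the bounds of chains for Zorn's lemma. The pointwise infimum is finite because
  of \<open>p0\<close>; it is subadditive because the smaller functional \<open>r\<close> of
  \<open>p\<close> and \<open>q\<close> satisfies \<open>r y + r z \<le> p y + q z\<close>.\<close>

lemma sublinear_Inf_chain:
  assumes "C \<noteq> {}"
    and sub: "\<And>p. p \<in> C \<Longrightarrow> sublinear p"
    and ub: "\<And>p. p \<in> C \<Longrightarrow> p \<le> p0"
    and chain: "\<And>p q. p \<in> C \<Longrightarrow> q \<in> C \<Longrightarrow> p \<le> q \<or> q \<le> p"
  obtains m where "sublinear m" "\<And>p. p \<in> C \<Longrightarrow> m \<le> p"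
proof
  define m where "m = (\<lambda>y. INF p\<in>C. p y)"
  have "- p0 (- y) \<le> p y" if "p \<in> C" for p y
    using sublinear_uminus_le[OF sub[OF that], of y] ub[OF that] by (smt (verit) le_fun_def)
  then have bdd: "bdd_below ((\<lambda>p. p y) ` C)" for y
    by (intro bdd_belowI[of _ "- p0 (- y)"]) auto
  have le: "m y \<le> p y" if "p \<in> C" for p y
    unfolding m_def by (rule cINF_lower[OF bdd that])
  have ge: "c \<le> m y" if "\<And>p. p \<in> C \<Longrightarrow> c \<le> p y" for c y
    unfolding m_def by (rule cINF_greatest[OF \<open>C \<noteq> {}\<close>]) (rule that)
  show "m \<le> p" if "p \<in> C" for p
    using le[OF that] by (simp add: le_fun_def)
  show "sublinear m"
  proof (rule sublinearI)
    fix y z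
    have "m (y + z) - p y \<le> m z" if p: "p \<in> C" for p
    proof (rule ge)
      fix q assume q: "q \<in> C"
      obtain r where r: "r \<in> C" "r \<le> p" "r \<le> q"
        using chain[OF p q] p q by blast
      have "m (y + z) \<le> r y + r z"
        using le[OF r(1), of "y + z"] sublinear_add[OF sub[OF r(1)], of y z] by linarith
      also have "\<dots> \<le> p y + q z"
        using r(2,3) by (intro add_mono) (auto simp: le_fun_def)
      finally show "m (y + z) - p y \<le> q z" by simp
    qed
    then have "m (y + z) - m z \<le> m y"
      by (intro ge) (simp add: algebra_simps)
    then show "m (y + z) \<le> m y + m z" by simp
  next
    fix r :: real and y assume r: "0 < r"
    have "m (r *\<^sub>R y) / r \<le> m y"
    proof (rule ge)
      fix p assume p: "p \<in> C"
      show "m (r *\<^sub>R y) / r \<le> p y"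
        using le[OF p, of "r *\<^sub>R y"] sublinear_scaleR[OF sub[OF p], of r y] r
        by (simp add: field_simps)
    qed
    then show "m (r *\<^sub>R y) \<le> r * m y"
      using r by (simp add: field_simps)
  next
    obtain p where "p \<in> C" using \<open>C \<noteq> {}\<close> by blast
    then show "m 0 \<le> 0"
      using le[of p 0] sublinear_0[OF sub, of p] by simp
  qed
qed

text \<open>Oddness turns subadditivity for \<open>x = (x + y) + (- y)\<close> into
  superadditivity.\<close>

lemma sublinear_odd_imp_linear:
  assumes p: "sublinear p" and odd: "\<And>x. p (- x) = - p x"
  shows "linear p"
proof (rule linearI)
  show "p (x + y) = p x + p y" for x y
    using sublinear_add[OF p, of x y] sublinear_add[OF p, of "x + y" "- y"] odd[of y] by simp
  show "p (r *\<^sub>R x) = r *\<^sub>R p x" for r x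
    using sublinear_scaleR[OF p, of r x] sublinear_scaleR[OF p, of "- r" x] odd[of "r *\<^sub>R x"]
    by (cases "0 \<le> r") auto
qed

text \<open>Hahn--Banach: by tilting, a minimal sublinear functional is odd, hence linear; tilting once
  more beforehand forces the prescribed value at \<open>x\<close>.\<close>

lemma linear_below_sublinear:
  assumes p: "sublinear p"
  obtains f where "linear f" "f \<le> p" "f x = p x"
proof -
  \<comment> \<open>Every functional below \<open>p1\<close> inherits the bound at
    \<open>- x\<close>, which oddness later turns into \<open>p x \<le> f x\<close>.\<close>
  obtain p1 where p1: "sublinear p1" "p1 \<le> p" "p1 (- x) \<le> - p x"
    using sublinear_tilt[OF p] .
  define Q where "Q = {q. sublinear q \<and> q \<le> p1}"
  \<comment> \<open>The order is reversed, so Zorn's maximal element is a minimal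
    functional.\<close>
  have "\<exists>m\<in>Q. \<forall>q\<in>Q. q \<le> m \<longrightarrow> q = m"
  proof (rule predicate_Zorn)
    show "partial_order_on Q (relation_of (\<lambda>p q. q \<le> p) Q)"
      by (rule partial_order_on_relation_ofI) auto
    fix C assume C: "C \<in> Chains (relation_of (\<lambda>p q. q \<le> p) Q)"
    show "\<exists>u\<in>Q. \<forall>q\<in>C. u \<le> q"
    proof (cases "C = {}")
      case True
      then show ?thesis using p1 by (auto simp: Q_def)
    next
      case False
      have CQ: "C \<subseteq> Q" using C by (rule Chains_relation_of)
      have chain: "q \<le> r \<or> r \<le> q" if "q \<in> C" "r \<in> C" for q r
        using C that by (auto simp: Chains_def relation_of_def)
      obtain m where m: "sublinear m" "\<And>q. q \<in> C \<Longrightarrow> m \<le> q"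
        using sublinear_Inf_chain[OF False, of p1] CQ chain by (auto simp: Q_def)
      moreover obtain q where "q \<in> C" using False by blast
      ultimately show ?thesis
        using CQ by (auto simp: Q_def intro: order_trans)
    qed
  qed
  then obtain f where f: "sublinear f" "f \<le> p1"
    and min: "\<And>q. sublinear q \<Longrightarrow> q \<le> f \<Longrightarrow> q = f"
    unfolding Q_def by (auto intro: order_trans)
  have odd: "f (- y) = - f y" for y
  proof (rule antisym)
    obtain q where "sublinear q" "q \<le> f" "q (- y) \<le> - f y"
      using sublinear_tilt[OF f(1)] .
    with min show "f (- y) \<le> - f y" by metis
    show "- f y \<le> f (- y)"
      using sublinear_uminus_le[OF f(1), of "- y"] by simp
  qed
  have fp: "f \<le> p" using f(2) p1(2) by (rule order_trans)
  moreover have "f x = p x"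
    using odd[of x] p1(3) f(2) fp by (smt (verit) le_fun_def)
  moreover have "linear f"
    using f(1) odd by (rule sublinear_odd_imp_linear)
  ultimately show thesis by (rule that[rotated])
qed

section \<open>Separating a point from a closed subspace\<close>

text \<open>The distance is the quotient seminorm modulo \<open>Y\<close>: competitors
  \<open>a\<close> for \<open>x\<close> and \<open>b\<close> for \<open>y\<close> yield
  \<open>a + b\<close> for \<open>x + y\<close>, and \<open>r *\<^sub>R a\<close> for
  \<open>r *\<^sub>R x\<close>.\<close>

lemma sublinear_infdist:
  fixes Y :: "'a::real_normed_vector set"
  assumes Y: "subspace Y"
  shows "sublinear (\<lambda>x. infdist x Y)"
proof (rule sublinearI)
  have ne: "Y \<noteq> {}" using subspace_0[OF Y] by blast
  have ge: "c \<le> infdist x Y" if "\<And>a. a \<in> Y \<Longrightarrow> c \<le> norm (x - a)" for c x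
    unfolding infdist_notempty[OF ne] by (rule cINF_greatest[OF ne]) (simp add: dist_norm that)
  have le: "infdist x Y \<le> norm (x - a)" if "a \<in> Y" for x a
    using infdist_le[OF that, of x] by (simp add: dist_norm)
  fix x y
  have "infdist (x + y) Y - norm (y - b) \<le> infdist x Y" if b: "b \<in> Y" for b
  proof (rule ge)
    fix a assume a: "a \<in> Y"
    have "infdist (x + y) Y \<le> norm ((x - a) + (y - b))"
      using le[OF subspace_add[OF Y a b], of "x + y"] by (simp add: algebra_simps)
    then show "infdist (x + y) Y - norm (y - b) \<le> norm (x - a)"
      using norm_triangle_ineq[of "x - a" "y - b"] by linarith
  qed
  then have "infdist (x + y) Y - infdist x Y \<le> infdist y Y"
    by (intro ge) (simp add: algebra_simps)
  then show "infdist (x + y) Y \<le> infdist x Y + infdist y Y" by simp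
next
  have ne: "Y \<noteq> {}" using subspace_0[OF Y] by blast
  fix r :: real and x assume r: "0 < r"
  have "infdist (r *\<^sub>R x) Y / r \<le> infdist x Y"
    unfolding infdist_notempty[OF ne, of x]
  proof (rule cINF_greatest[OF ne])
    fix a assume "a \<in> Y"
    then have "infdist (r *\<^sub>R x) Y \<le> dist (r *\<^sub>R x) (r *\<^sub>R a)"
      by (intro infdist_le subspace_scale[OF Y])
    also have "dist (r *\<^sub>R x) (r *\<^sub>R a) = r * dist x a"
      using r by (simp add: dist_norm flip: scaleR_diff_right)
    finally show "infdist (r *\<^sub>R x) Y / r \<le> dist x a"
      using r by (simp add: field_simps)
  qed
  then show "infdist (r *\<^sub>R x) Y \<le> r * infdist x Y"
    using r by (simp add: field_simps)
qed (use subspace_0[OF Y] in simp)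

text \<open>The distance to \<open>Y\<close> serves as the Hahn--Banach majorant. It vanishes on
  \<open>Y\<close>, is at most the norm, and is positive at \<open>x\<close> because
  \<open>Y\<close> is closed.\<close>

lemma real_functional_separating:
  fixes x :: "'a::real_normed_vector"
  assumes Y: "subspace Y" "closed Y" and "x \<notin> Y"
  obtains g :: "'a \<Rightarrow> real" where "bounded_linear g" "\<And>y. y \<in> Y \<Longrightarrow> g y = 0" "g x \<noteq> 0"
proof -
  obtain g where g: "linear g" "g \<le> (\<lambda>x. infdist x Y)" "g x = infdist x Y"
    using linear_below_sublinear[OF sublinear_infdist[OF Y(1)]] .
  have le: "g y \<le> infdist y Y" for y
    using g(2) by (simp add: le_fun_def)
  have Y0: "0 \<in> Y" using Y(1) by (rule subspace_0)
  have leN: "g y \<le> norm y" for y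
    using order_trans[OF le infdist_le[OF Y0]] by (simp add: dist_norm)
  have "bounded_linear g"
    using g(1) unfolding bounded_linear_def bounded_linear_axioms_def
  proof (intro conjI exI[of _ 1] allI)
    show "norm (g y) \<le> norm y * 1" for y
      using leN[of y] leN[of "- y"] linear_neg[OF g(1), of y] by simp
  qed
  moreover have "g y = 0" if "y \<in> Y" for y
    using le[of y] le[of "- y"] linear_neg[OF g(1), of y] that subspace_neg[OF Y(1) that] by simp
  moreover have "g x \<noteq> 0"
    using g(3) \<open>x \<notin> Y\<close> Y Y0 in_closed_iff_infdist_zero[of Y x] by auto
  ultimately show thesis by (rule that)
qed

section \<open>From real functionals to functionals over the scalar field\<close>

text \<open>A real functional \<open>g\<close> on the Banach space is the composition of a fixed coordinate of the scalar
  field with a unique \<open>'k\<close>-linear functional, since multiplication followed by that coordinate is a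
  nondegenerate bilinear form on the field.\<close>

context banach_space
begin

lemma bounded_linear_scale: "bounded_linear (s c)"
proof (rule bounded_linear_intro)
  show "s c (r *\<^sub>R x) = r *\<^sub>R s c x" for r x
    by (simp add: scale_of_real[symmetric] mult.commute)
  show "norm (s c x) \<le> norm x * norm c" for x
    by (simp add: norm_scale mult.commute)
qed (rule scale_right_distrib)

lemma scale_scaleR: "s (r *\<^sub>R c) x = r *\<^sub>R s c x"
  by (simp add: scaleR_conv_of_real scale_of_real flip: scale_scale)

text \<open>\<open>d\<close> is the basis dual to \<open>Basis\<close> under the bilinear form
  \<open>(c * a) \<bullet> e\<close>. It exists because the map \<open>M\<close> representing this
  form is injective, hence onto in finite dimension.\<close>

lemma dual_basis:
  fixes e :: 'k
  assumes "e \<in> Basis"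
  obtains d where "\<And>b c :: 'k. b \<in> Basis \<Longrightarrow> (c * d b) \<bullet> e = c \<bullet> b"
proof -
  define M where "M = (\<lambda>a::'k. \<Sum>b\<in>Basis. ((b * a) \<bullet> e) *\<^sub>R b)"
  have Mb: "M a \<bullet> b = (b * a) \<bullet> e" if "b \<in> Basis" for a b
    using that by (simp add: M_def)
  have Mc: "c \<bullet> M a = (c * a) \<bullet> e" for a c
  proof -
    have "(c * a) \<bullet> e = ((\<Sum>b\<in>Basis. (c \<bullet> b) *\<^sub>R b) * a) \<bullet> e"
      by (simp add: euclidean_representation)
    also have "\<dots> = (\<Sum>b\<in>Basis. (c \<bullet> b) * ((b * a) \<bullet> e))"
      by (simp add: sum_distrib_right inner_sum_left)
    also have "\<dots> = c \<bullet> M a"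
      by (simp add: M_def inner_sum_right mult.commute)
    finally show ?thesis by simp
  qed
  have lin: "linear M"
    unfolding M_def
    by (intro linearI) (simp_all add: algebra_simps inner_add_left sum.distrib scaleR_sum_right)
  have "inj M"
    unfolding linear_injective_0[OF lin]
  proof (intro allI impI, rule ccontr)
    \<comment> \<open>For \<open>c = e * inverse a\<close> the form takes the value
      \<open>e \<bullet> e = 1\<close>, although \<open>c \<bullet> M a = 0\<close>.\<close>
    fix a assume "M a = 0" "a \<noteq> 0"
    then show False
      using Mc[of "e * inverse a" a] \<open>e \<in> Basis\<close> by (simp add: mult.assoc)
  qed
  then have "surj M"
    by (rule linear_inj_imp_surj[OF lin])
  then have "M (inv M b) = b" for b
    by (rule surj_f_inv_f)
  then have "(c * inv M b) \<bullet> e = c \<bullet> b" for b c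
    using Mc[of c "inv M b"] by simp
  then show thesis by (rule that)
qed

lemma dual_space_separating:
  assumes Y: "module.subspace s Y" "closed Y" and "x \<notin> Y"
  obtains f where "f \<in> dual_space s" "\<And>y. y \<in> Y \<Longrightarrow> blinfun_apply f y = 0" "blinfun_apply f x = 1"
proof -
  have scaleR_Y: "r *\<^sub>R y \<in> Y" if "y \<in> Y" for r y
    using subspace_scale[OF Y(1) that, of "of_real r"] by (simp add: scale_of_real)
  have "real_vector.subspace Y"
    using subspace_0[OF Y(1)] subspace_add[OF Y(1)] scaleR_Y
    by (intro real_vector.subspaceI) auto
  then obtain g :: "'a \<Rightarrow> real"
    where g: "bounded_linear g" "\<And>y. y \<in> Y \<Longrightarrow> g y = 0" "g x \<noteq> 0"
    using real_functional_separating Y(2) \<open>x \<notin> Y\<close> by metis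
  interpret g: bounded_linear g by (rule g(1))
  obtain e :: 'k where e: "e \<in> Basis"
    using nonempty_Basis by blast
  obtain d :: "'k \<Rightarrow> 'k" where d: "\<And>b c. b \<in> Basis \<Longrightarrow> (c * d b) \<bullet> e = c \<bullet> b"
    using dual_basis[OF e] by blast
  \<comment> \<open>The coefficients \<open>d b\<close> are chosen so that
    \<open>(c * h z) \<bullet> e = g (s c z)\<close> for all \<open>c\<close>.\<close>
  define h where "h = (\<lambda>z. \<Sum>b\<in>Basis. g (s b z) *\<^sub>R d b)"
  have h_e: "(c * h z) \<bullet> e = g (s c z)" for c z
  proof -
    have "(c * h z) \<bullet> e = (\<Sum>b\<in>Basis. (c \<bullet> b) * g (s b z))"
      by (simp add: h_def sum_distrib_left inner_sum_left d mult.commute)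
    also have "\<dots> = g (s (\<Sum>b\<in>Basis. (c \<bullet> b) *\<^sub>R b) z)"
      by (simp add: scale_sum_left scale_scaleR g.sum g.scaleR)
    finally show ?thesis by (simp add: euclidean_representation)
  qed
  have eqI: "u = v" if "\<And>c. (c * u) \<bullet> e = (c * v) \<bullet> e" for u v :: 'k
  proof (rule ccontr)
    assume "u \<noteq> v"
    then have "e \<bullet> e = (e * inverse (u - v) * (u - v)) \<bullet> e"
      by (simp add: mult.assoc)
    also have "\<dots> = 0"
      using that[of "e * inverse (u - v)"] by (simp only: right_diff_distrib inner_diff_left)
    finally show False using e by simp
  qed
  \<comment> \<open>By \<open>eqI\<close>, the identity \<open>h_e\<close> determines
    \<open>h\<close>, so homogeneity reduces to associativity.\<close>
  have h_scale: "h (s c z) = c * h z" for c z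
    by (rule eqI) (metis h_e scale_scale mult.assoc)
  have "bounded_linear h"
    unfolding h_def
    by (intro bounded_linear_sum bounded_linear_compose[OF bounded_linear_scaleR_left]
        bounded_linear_compose[OF g(1)] bounded_linear_scale)
  then have bl: "bounded_linear (\<lambda>z. h z / h x)"
    by (rule bounded_linear_compose[OF bounded_linear_divide])
  have hx: "h x \<noteq> 0"
    using h_e[of 1 x] g(3) by auto
  have app: "blinfun_apply (Blinfun (\<lambda>z. h z / h x)) z = h z / h x" for z
    by (simp add: bounded_linear_Blinfun_apply[OF bl])
  show thesis
  proof
    show "Blinfun (\<lambda>z. h z / h x) \<in> dual_space s"
      by (simp add: dual_space_def app h_scale)
    show "blinfun_apply (Blinfun (\<lambda>z. h z / h x)) y = 0" if "y \<in> Y" for y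
      using g(2) subspace_scale[OF Y(1) that] by (simp add: app hx) (simp add: h_def)
    show "blinfun_apply (Blinfun (\<lambda>z. h z / h x)) x = 1"
      using hx by (simp add: app)
  qed
qed

end

section \<open>The defect of an operator relative to \<open>Y\<close>\<close>

text \<open>For linear \<open>T\<close> and a subspace \<open>Y\<close> this means that
  \<open>(Y + T Y) / Y\<close> has dimension at most \<open>n\<close>, expressed without a quotient
  space.\<close>

definition defect_le ::
  "('k::{real_normed_field, euclidean_space} \<Rightarrow> 'a::banach \<Rightarrow> 'a) \<Rightarrow> 'a set \<Rightarrow> nat \<Rightarrow> ('a \<Rightarrow>\<^sub>L 'a) \<Rightarrow> bool"
  where "defect_le s Y n T \<longleftrightarrow>
     (\<exists>B. finite B \<and> card B \<le> n \<and> (\<forall>y\<in>Y. \<exists>b\<in>module.span s B. blinfun_apply T y - b \<in> Y))"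

text \<open>An indexed family may repeat a value while its image is independent; the coefficients
  \<open>1\<close> and \<open>- 1\<close> at two equal entries then give the relation.\<close>

lemma (in vector_space) exists_dependency:
  fixes v :: "nat \<Rightarrow> 'b"
  assumes "finite B" "card B \<le> n" and v: "\<And>i. i \<le> n \<Longrightarrow> v i \<in> span B"
  obtains d where "\<exists>i\<le>n. d i \<noteq> 0" "(\<Sum>i\<le>n. scale (d i) (v i)) = 0"
proof (cases "inj_on v {..n}")
  case True
  have "dependent (v ` {..n})"
  proof (rule ccontr)
    assume "independent (v ` {..n})"
    then have "card (v ` {..n}) \<le> card B"
      using independent_span_bound[OF \<open>finite B\<close>] v by blast
    then show False
      using assms(2) card_image[OF True] by simp
  qed
  then obtain u where "\<exists>w\<in>v ` {..n}. u w \<noteq> 0" "(\<Sum>w\<in>v ` {..n}. scale (u w) w) = 0"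
    using dependent_finite[of "v ` {..n}"] by auto
  then show thesis
    using that[of "u \<circ> v"] sum.reindex[OF True, of "\<lambda>w. scale (u w) w"] by auto
next
  case False
  then obtain i j where ij: "i \<le> n" "j \<le> n" "i \<noteq> j" "v i = v j"
    by (auto simp: inj_on_def)
  define d :: "nat \<Rightarrow> 'a" where "d = (\<lambda>k. if k = i then 1 else if k = j then - 1 else 0)"
  have "(\<Sum>k\<le>n. scale (d k) (v k)) = (\<Sum>k\<in>{i, j}. scale (d k) (v k))"
    using ij by (intro sum.mono_neutral_right) (auto simp: d_def)
  also have "\<dots> = 0"
    using ij by (simp add: d_def)
  finally have "(\<Sum>k\<le>n. scale (d k) (v k)) = 0" .
  moreover have "d i \<noteq> 0"
    by (simp add: d_def)
  ultimately show thesis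
    using that ij(1) by blast
qed

context banach_space
begin

lemma almost_invariant_iff_defect_le: "almost_invariant s Y T \<longleftrightarrow> (\<exists>n. defect_le s Y n T)"
proof
  assume "almost_invariant s Y T"
  then obtain F where F: "finite_dimensional s F"
    "blinfun_apply T ` Y \<subseteq> {y + f | y f. y \<in> Y \<and> f \<in> F}"
    unfolding almost_invariant_def by blast
  then obtain B where B: "finite B" "module.span s B = F"
    unfolding finite_dimensional_def by blast
  have "\<exists>b\<in>module.span s B. blinfun_apply T y - b \<in> Y" if y: "y \<in> Y" for y
  proof -
    obtain z b where "blinfun_apply T y = z + b" "z \<in> Y" "b \<in> module.span s B"
      using F(2) y unfolding B(2) by blast
    then show ?thesis by (intro bexI[of _ b]) auto
  qed
  with B(1) show "\<exists>n. defect_le s Y n T"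
    unfolding defect_le_def by blast
next
  assume "\<exists>n. defect_le s Y n T"
  then obtain B where B: "finite B" "\<And>y. y \<in> Y \<Longrightarrow> \<exists>b\<in>module.span s B. blinfun_apply T y - b \<in> Y"
    unfolding defect_le_def by blast
  have "finite_dimensional s (module.span s B)"
    unfolding finite_dimensional_def
    by (rule exI[of _ B]) (use B(1) span_superset in blast)
  moreover have "blinfun_apply T ` Y \<subseteq> {y + f | y f. y \<in> Y \<and> f \<in> module.span s B}"
  proof clarify
    fix y assume "y \<in> Y"
    then obtain b where "b \<in> module.span s B" "blinfun_apply T y - b \<in> Y"
      using B(2) by blast
    then show "\<exists>z f. blinfun_apply T y = z + f \<and> z \<in> Y \<and> f \<in> module.span s B"
      by (intro exI[of _ "blinfun_apply T y - b"] exI[of _ b]) simp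
  qed
  ultimately show "almost_invariant s Y T"
    unfolding almost_invariant_def using subspace_span by blast
qed

lemma defect_le_diff:
  assumes Y: "module.subspace s Y" and "defect_le s Y m S" "defect_le s Y n T"
  shows "defect_le s Y (m + n) (S - T)"
proof -
  obtain B C
    where B: "finite B" "card B \<le> m" "\<And>y. y \<in> Y \<Longrightarrow> \<exists>b\<in>module.span s B. blinfun_apply S y - b \<in> Y"
      and C: "finite C" "card C \<le> n" "\<And>y. y \<in> Y \<Longrightarrow> \<exists>c\<in>module.span s C. blinfun_apply T y - c \<in> Y"
    using assms(2,3) unfolding defect_le_def by metis
  have "\<exists>d\<in>module.span s (B \<union> C). blinfun_apply (S - T) y - d \<in> Y" if y: "y \<in> Y" for y
  proof -
    obtain b where b: "b \<in> module.span s B" "blinfun_apply S y - b \<in> Y" using B(3)[OF y] by blast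
    obtain c where c: "c \<in> module.span s C" "blinfun_apply T y - c \<in> Y" using C(3)[OF y] by blast
    have "b - c \<in> module.span s (B \<union> C)"
      using b(1) c(1) span_mono[of B "B \<union> C"] span_mono[of C "B \<union> C"]
      by (intro span_diff) auto
    moreover have "blinfun_apply (S - T) y - (b - c) = (blinfun_apply S y - b) - (blinfun_apply T y - c)"
      by (simp add: blinfun.diff_left)
    ultimately show ?thesis
      using subspace_diff[OF Y b(2) c(2)] by metis
  qed
  moreover have "card (B \<union> C) \<le> m + n"
    using card_Un_le[of B C] B(2) C(2) by linarith
  ultimately show ?thesis
    unfolding defect_le_def using B(1) C(1) by blast
qed

lemma defect_le_scale:
  assumes Y: "module.subspace s Y" and "defect_le s Y n T"
  shows "defect_le s Y n (scale_operator s c T)"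
proof -
  obtain B
    where B: "finite B" "card B \<le> n" "\<And>y. y \<in> Y \<Longrightarrow> \<exists>b\<in>module.span s B. blinfun_apply T y - b \<in> Y"
    using assms(2) unfolding defect_le_def by metis
  have "\<exists>b\<in>module.span s B. blinfun_apply (scale_operator s c T) y - b \<in> Y" if y: "y \<in> Y" for y
  proof -
    obtain b where b: "b \<in> module.span s B" "blinfun_apply T y - b \<in> Y" using B(3)[OF y] by blast
    have "blinfun_apply (scale_operator s c T) y - s c b \<in> Y"
      using subspace_scale[OF Y b(2), of c]
      by (simp add: scale_operator_apply scale_right_diff_distrib)
    then show ?thesis using span_scale[OF b(1)] by blast
  qed
  with B(1,2) show ?thesis
    unfolding defect_le_def by blast
qed

section \<open>Biorthogonal systems and weak limits\<close>

text \<open>A two-sided Gram--Schmidt process: at most \<open>n\<close> vectors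
  \<open>T (y i)\<close> cannot span \<open>T Y\<close> modulo \<open>Y\<close>, so a new vector and
  a new functional exist and are corrected against the earlier ones.\<close>

lemma biorthogonal_system:
  assumes Y: "module.subspace s Y" "closed Y" and T: "T \<in> bounded_operators s"
    and defect: "\<not> defect_le s Y n T" and "k \<le> Suc n"
  shows "\<exists>y f. (\<forall>i<k. y i \<in> Y) \<and>
     (\<forall>j<k. f j \<in> dual_space s \<and> (\<forall>z\<in>Y. blinfun_apply (f j) z = 0)) \<and>
     (\<forall>i<k. \<forall>j<k. blinfun_apply (f j) (blinfun_apply T (y i)) = (if i = j then 1 else 0))"
  using \<open>k \<le> Suc n\<close>
proof (induction k)
  case 0
  then show ?case by simp
next
  case (Suc k)
  from Suc.IH obtain y f where y: "\<And>i. i < k \<Longrightarrow> y i \<in> Y"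
    and f: "\<And>j. j < k \<Longrightarrow> f j \<in> dual_space s" "\<And>j z. j < k \<Longrightarrow> z \<in> Y \<Longrightarrow> blinfun_apply (f j) z = 0"
    and fy: "\<And>i j. i < k \<Longrightarrow> j < k \<Longrightarrow>
      blinfun_apply (f j) (blinfun_apply T (y i)) = (if i = j then 1 else 0)"
    using Suc_leD[OF Suc.prems] by atomize_elim blast
  let ?B = "(\<lambda>i. blinfun_apply T (y i)) ` {..<k}"
  have "finite ?B" "card ?B \<le> n"
    using card_image_le[of "{..<k}" "\<lambda>i. blinfun_apply T (y i)"] Suc.prems by auto
  then obtain w where w: "w \<in> Y" "\<And>b. b \<in> module.span s ?B \<Longrightarrow> blinfun_apply T w - b \<notin> Y"
    using defect unfolding defect_le_def by blast
  \<comment> \<open>Removing the components along the earlier vectors makes each \<open>f j\<close>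
    vanish at \<open>T yk\<close>. It changes \<open>T w\<close> only within the span of
    \<open>?B\<close>, so \<open>T yk\<close> stays outside \<open>Y\<close>.\<close>
  define yk where "yk = w - (\<Sum>j<k. s (blinfun_apply (f j) (blinfun_apply T w)) (y j))"
  have T_scale: "blinfun_apply T (s c x) = s c (blinfun_apply T x)" for c x
    using T by (simp add: bounded_operators_def)
  have f_scale: "blinfun_apply (f j) (s c x) = c * blinfun_apply (f j) x" if "j < k" for j c x
    using f(1)[OF that] by (simp add: dual_space_def)
  have T_yk: "blinfun_apply T yk = blinfun_apply T w -
      (\<Sum>j<k. s (blinfun_apply (f j) (blinfun_apply T w)) (blinfun_apply T (y j)))"
    by (simp add: yk_def blinfun.diff_right blinfun.sum_right T_scale)
  have yk: "yk \<in> Y"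
    unfolding yk_def using w(1) y
    by (intro subspace_diff[OF Y(1)] subspace_sum[OF Y(1)] subspace_scale[OF Y(1)]) auto
  have "blinfun_apply T yk \<notin> Y"
    unfolding T_yk by (intro w(2) span_sum span_scale span_base) auto
  then obtain g where g: "g \<in> dual_space s" "\<And>z. z \<in> Y \<Longrightarrow> blinfun_apply g z = 0"
    "blinfun_apply g (blinfun_apply T yk) = 1"
    using dual_space_separating[OF Y] by blast
  have f_yk: "blinfun_apply (f j) (blinfun_apply T yk) = 0" if j: "j < k" for j
  proof -
    have "blinfun_apply (f j) (blinfun_apply T yk) = blinfun_apply (f j) (blinfun_apply T w) -
        (\<Sum>i<k. blinfun_apply (f i) (blinfun_apply T w) * (if i = j then 1 else 0))"
      by (simp add: T_yk blinfun.diff_right blinfun.sum_right f_scale[OF j] fy j)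
    also have "\<dots> = 0"
      using j by (simp add: if_distrib cong: if_cong)
    finally show ?thesis .
  qed
  \<comment> \<open>The correction makes \<open>fk\<close> vanish at each \<open>T (y i)\<close>;
    the value \<open>1\<close> of \<open>g\<close> at \<open>T yk\<close> survives because the
    \<open>f i\<close> vanish there.\<close>
  define fk where
    "fk = g - (\<Sum>i<k. blinfun_mult_right (blinfun_apply g (blinfun_apply T (y i))) o\<^sub>L f i)"
  have fk_apply: "blinfun_apply fk z =
      blinfun_apply g z - (\<Sum>i<k. blinfun_apply g (blinfun_apply T (y i)) * blinfun_apply (f i) z)" for z
    by (simp add: fk_def blinfun.diff_left blinfun.sum_left)
  have "blinfun_apply fk (s c x) = c * blinfun_apply fk x" for c x
    using g(1)
    by (simp add: fk_apply f_scale dual_space_def right_diff_distrib sum_distrib_left mult.left_commute)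
  then have fk: "fk \<in> dual_space s"
    by (simp add: dual_space_def)
  have fk_Y: "blinfun_apply fk z = 0" if "z \<in> Y" for z
    using that by (simp add: fk_apply g(2) f(2))
  have fk_yk: "blinfun_apply fk (blinfun_apply T yk) = 1"
    by (simp add: fk_apply g(3) f_yk)
  have fk_y: "blinfun_apply fk (blinfun_apply T (y i)) = 0" if i: "i < k" for i
  proof -
    have "blinfun_apply fk (blinfun_apply T (y i)) = blinfun_apply g (blinfun_apply T (y i)) -
        (\<Sum>j<k. blinfun_apply g (blinfun_apply T (y j)) * (if i = j then 1 else 0))"
      using i by (simp add: fk_apply fy)
    also have "\<dots> = 0"
      using i by (simp add: if_distrib cong: if_cong)
    finally show ?thesis .
  qed
  show ?case
    by (rule exI[of _ "y(k := yk)"], rule exI[of _ "f(k := fk)"])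
      (use y f fy yk fk fk_Y fk_yk fk_y f_yk in \<open>auto simp: less_Suc_eq\<close>)
qed

text \<open>A matrix close to the identity is diagonally dominant, hence regular, whereas an operator of
  defect at most \<open>n\<close> yields a singular one on any \<open>n + 1\<close> vectors and functionals.\<close>

lemma defect_le_weak_limit:
  assumes Y: "module.subspace s Y" "closed Y" and T: "T \<in> bounded_operators s"
    and approx: "\<And>F V \<epsilon>. finite F \<Longrightarrow> F \<subseteq> dual_space s \<Longrightarrow> finite V \<Longrightarrow> 0 < \<epsilon> \<Longrightarrow>
      \<exists>S. defect_le s Y n S \<and>
        (\<forall>f\<in>F. \<forall>x\<in>V. norm (blinfun_apply f (blinfun_apply S x) - blinfun_apply f (blinfun_apply T x)) < \<epsilon>)"
  shows "defect_le s Y n T"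
proof (rule ccontr)
  assume "\<not> defect_le s Y n T"
  from biorthogonal_system[OF Y T this order_refl, unfolded less_Suc_eq_le]
  obtain y f where y: "\<And>i. i \<le> n \<Longrightarrow> y i \<in> Y"
    and f: "\<And>j. j \<le> n \<Longrightarrow> f j \<in> dual_space s" "\<And>j z. j \<le> n \<Longrightarrow> z \<in> Y \<Longrightarrow> blinfun_apply (f j) z = 0"
    and fy: "\<And>i j. i \<le> n \<Longrightarrow> j \<le> n \<Longrightarrow>
      blinfun_apply (f j) (blinfun_apply T (y i)) = (if i = j then 1 else 0)"
    by atomize_elim blast
  \<comment> \<open>Below, \<open>n + 1\<close> errors, each less than
    \<open>norm (d j) * \<epsilon>\<close>, must add up to less than
    \<open>norm (d j)\<close>.\<close>
  define \<epsilon> where "\<epsilon> = 1 / real (Suc n)"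
  have "\<exists>S. defect_le s Y n S \<and> (\<forall>g\<in>f ` {..n}. \<forall>x\<in>y ` {..n}.
      norm (blinfun_apply g (blinfun_apply S x) - blinfun_apply g (blinfun_apply T x)) < \<epsilon>)"
    by (rule approx) (use f(1) in \<open>auto simp: \<epsilon>_def\<close>)
  then obtain S where S: "defect_le s Y n S"
    and near_T: "\<forall>g\<in>f ` {..n}. \<forall>x\<in>y ` {..n}.
      norm (blinfun_apply g (blinfun_apply S x) - blinfun_apply g (blinfun_apply T x)) < \<epsilon>"
    by blast
  have near: "norm (blinfun_apply (f j) (blinfun_apply S (y i)) - (if i = j then 1 else 0)) < \<epsilon>"
    if "i \<le> n" "j \<le> n" for i j
    using near_T[rule_format, of "f j" "y i"] that by (simp add: fy)
  obtain B where B: "finite B" "card B \<le> n"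
    "\<And>z. z \<in> Y \<Longrightarrow> \<exists>b\<in>module.span s B. blinfun_apply S z - b \<in> Y"
    using S unfolding defect_le_def by blast
  \<comment> \<open>Modulo \<open>Y\<close>, the \<open>n + 1\<close> vectors \<open>S (y i)\<close>
    have representatives in a span of at most \<open>n\<close> vectors, which forces a linear
    relation.\<close>
  have "\<forall>i\<in>{..n}. \<exists>b. b \<in> module.span s B \<and> blinfun_apply S (y i) - b \<in> Y"
    using B(3) y by blast
  from bchoice[OF this] obtain v where v: "\<And>i. i \<le> n \<Longrightarrow> v i \<in> module.span s B"
    "\<And>i. i \<le> n \<Longrightarrow> blinfun_apply S (y i) - v i \<in> Y"
    by auto
  obtain d where d: "\<exists>i\<le>n. d i \<noteq> 0" "(\<Sum>i\<le>n. s (d i) (v i)) = 0"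
    using exists_dependency[OF B(1,2), of v] v(1) by blast
  have "(\<Sum>i\<le>n. s (d i) (blinfun_apply S (y i))) = (\<Sum>i\<le>n. s (d i) (blinfun_apply S (y i) - v i))"
    using d(2) by (simp add: scale_right_diff_distrib sum_subtractf)
  also have "\<dots> \<in> Y"
    using v(2) by (intro subspace_sum[OF Y(1)] subspace_scale[OF Y(1)]) auto
  finally have comb: "(\<Sum>i\<le>n. s (d i) (blinfun_apply S (y i))) \<in> Y" .
  \<comment> \<open>The combination lies in \<open>Y\<close>, where \<open>f j\<close> vanishes, so
    \<open>d\<close> is a nontrivial relation for the whole matrix.\<close>
  have singular: "(\<Sum>i\<le>n. d i * blinfun_apply (f j) (blinfun_apply S (y i))) = 0" if "j \<le> n" for j
    using f(2)[OF that comb] f(1)[OF that] by (simp add: blinfun.sum_right dual_space_def)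
  \<comment> \<open>Diagonal dominance is contradicted in the equation whose index \<open>j\<close>
    carries the largest coefficient.\<close>
  have "Max ((\<lambda>i. norm (d i)) ` {..n}) \<in> (\<lambda>i. norm (d i)) ` {..n}"
    by (rule Max_in) auto
  then obtain j where "j \<le> n" "norm (d j) = Max ((\<lambda>i. norm (d i)) ` {..n})"
    by (elim imageE) (metis atMost_iff)
  then have j: "j \<le> n" "\<And>i. i \<le> n \<Longrightarrow> norm (d i) \<le> norm (d j)"
    by auto
  obtain i where "i \<le> n" "d i \<noteq> 0"
    using d(1) by blast
  then have dj: "0 < norm (d j)"
    using less_le_trans[OF _ j(2), of 0 i] by simp
  have "d j = (\<Sum>i\<le>n. d i * (if i = j then 1 else 0))"
    using j(1) by (simp add: if_distrib cong: if_cong)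
  also have "\<dots> = - (\<Sum>i\<le>n. d i * (blinfun_apply (f j) (blinfun_apply S (y i)) - (if i = j then 1 else 0)))"
    using singular[OF j(1)] by (simp only: right_diff_distrib sum_subtractf diff_0 minus_minus)
  finally have "norm (d j) \<le>
      (\<Sum>i\<le>n. norm (d i * (blinfun_apply (f j) (blinfun_apply S (y i)) - (if i = j then 1 else 0))))"
    by (simp only: norm_minus_cancel norm_sum)
  also have "\<dots> < (\<Sum>i\<le>n. norm (d j) * \<epsilon>)"
  proof (rule sum_strict_mono)
    fix i assume "i \<in> {..n}"
    then have i: "i \<le> n" by simp
    show "norm (d i * (blinfun_apply (f j) (blinfun_apply S (y i)) - (if i = j then 1 else 0))) < norm (d j) * \<epsilon>"
      unfolding norm_mult
      by (rule le_less_trans[OF mult_right_mono[OF j(2)[OF i] norm_ge_zero]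
            mult_strict_left_mono[OF near[OF i j(1)] dj]])
  qed auto
  also have "\<dots> = norm (d j)"
    by (simp add: \<epsilon>_def)
  finally show False by simp
qed

text \<open>Norm convergence makes finitely many values \<open>f (S k x)\<close> converge
  simultaneously. This is what makes the sets in the Baire argument closed.\<close>

lemma defect_le_norm_limit:
  assumes Y: "module.subspace s Y" "closed Y" and T: "T \<in> bounded_operators s"
    and S: "\<And>k. defect_le s Y n (S k)" "S \<longlonglongrightarrow> T"
  shows "defect_le s Y n T"
proof (rule defect_le_weak_limit[OF Y T])
  fix F :: "('a \<Rightarrow>\<^sub>L 'k) set" and V :: "'a set" and \<epsilon> :: real
  assume FV: "finite F" "finite V" and "0 < \<epsilon>"
  have "\<forall>\<^sub>F k in sequentially. dist (blinfun_apply f (blinfun_apply (S k) x)) (blinfun_apply f (blinfun_apply T x)) < \<epsilon>"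
    for f :: "'a \<Rightarrow>\<^sub>L 'k" and x
    by (rule tendstoD[OF _ \<open>0 < \<epsilon>\<close>]) (intro tendsto_intros S(2))
  then have "\<forall>\<^sub>F k in sequentially. \<forall>f\<in>F. \<forall>x\<in>V.
      norm (blinfun_apply f (blinfun_apply (S k) x) - blinfun_apply f (blinfun_apply T x)) < \<epsilon>"
    using FV by (simp add: eventually_ball_finite_distrib dist_norm)
  then show "\<exists>S. defect_le s Y n S \<and> (\<forall>f\<in>F. \<forall>x\<in>V.
      norm (blinfun_apply f (blinfun_apply S x) - blinfun_apply f (blinfun_apply T x)) < \<epsilon>)"
    using S(1) eventually_happens'[OF sequentially_bot] by blast
qed

text \<open>Each approximation required by \<open>defect_le_weak_limit\<close> involves finitely
  many pairs \<open>(f, x)\<close>, so it describes a weak operator neighbourhood of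
  \<open>T\<close>, which meets \<open>A\<close>.\<close>

lemma defect_le_closure_of:
  assumes Y: "module.subspace s Y" "closed Y"
    and A: "\<And>S. S \<in> A \<Longrightarrow> defect_le s Y n S"
    and T: "T \<in> weak_operator_topology s closure_of A"
  shows "defect_le s Y n T"
proof -
  have T': "T \<in> bounded_operators s"
    using T by (simp add: in_closure_of topspace_weak_operator_topology)
  show ?thesis
  proof (rule defect_le_weak_limit[OF Y T'])
    fix F :: "('a \<Rightarrow>\<^sub>L 'k) set" and V :: "'a set" and \<epsilon> :: real
    assume F: "finite F" "F \<subseteq> dual_space s" and V: "finite V" and \<epsilon>: "0 < \<epsilon>"
    let ?N = "\<lambda>(f, x). {S \<in> bounded_operators s.
      blinfun_apply f (blinfun_apply S x) \<in> ball (blinfun_apply f (blinfun_apply T x)) \<epsilon>}"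
    have "openin (weak_operator_topology s) (?N (f, x))" if "f \<in> F" for f x
      unfolding weak_operator_topology_def
      by (rule topology_generated_by_Basis, intro CollectI exI[of _ f] exI[of _ x]
          exI[of _ "ball (blinfun_apply f (blinfun_apply T x)) \<epsilon>"]) (use that F(2) in auto)
    \<comment> \<open>Intersecting with the whole space covers an empty \<open>F \<times> V\<close>,
      whose indexed intersection is \<open>UNIV\<close>.\<close>
    then have "openin (weak_operator_topology s) ((\<Inter>p\<in>F \<times> V. ?N p) \<inter> bounded_operators s)"
      using F(1) V openin_INT[of "F \<times> V" "weak_operator_topology s" ?N]
      by (auto simp: topspace_weak_operator_topology)
    moreover have "T \<in> (\<Inter>p\<in>F \<times> V. ?N p) \<inter> bounded_operators s"
      using T' \<epsilon> by auto
    ultimately obtain S where "S \<in> A" "S \<in> (\<Inter>p\<in>F \<times> V. ?N p) \<inter> bounded_operators s"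
      using T unfolding in_closure_of by blast
    then show "\<exists>S. defect_le s Y n S \<and> (\<forall>f\<in>F. \<forall>x\<in>V.
        norm (blinfun_apply f (blinfun_apply S x) - blinfun_apply f (blinfun_apply T x)) < \<epsilon>)"
      using A by (intro exI[of _ S]) (auto simp: dist_norm norm_minus_commute)
  qed
qed

section \<open>A uniform bound from Baire's theorem\<close>

text \<open>The bound is \<open>n + n\<close> because \<open>t *\<^sub>R T\<close> is the difference
  of \<open>T0 + t *\<^sub>R T\<close> and \<open>T0\<close>, both of defect at most
  \<open>n\<close>; rescaling then recovers \<open>T\<close>.\<close>

lemma uniform_defect:
  assumes Y: "module.subspace s Y" "closed Y"
    and A: "A \<subseteq> bounded_operators s" "closed A" "0 \<in> A"
      "\<And>S T. S \<in> A \<Longrightarrow> T \<in> A \<Longrightarrow> S + T \<in> A" "\<And>c T. T \<in> A \<Longrightarrow> scale_operator s c T \<in> A"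
    and defect: "\<And>T. T \<in> A \<Longrightarrow> \<exists>n. defect_le s Y n T"
  obtains N where "\<And>T. T \<in> A \<Longrightarrow> defect_le s Y N T"
proof -
  let ?X = "top_of_set A"
  define D where "D = (\<lambda>n. {T \<in> A. defect_le s Y n T})"
  have closed_D: "closed (D n)" for n
    unfolding closed_sequential_limits
  proof (intro allI impI, elim conjE)
    fix S T assume S: "\<forall>k. S k \<in> D n" "S \<longlonglongrightarrow> T"
    then have "T \<in> A"
      using closed_sequentially[OF A(2), of S T] by (simp add: D_def)
    moreover have "defect_le s Y n T"
      using defect_le_norm_limit[OF Y, of T n S] S A(1) \<open>T \<in> A\<close> by (auto simp: D_def)
    ultimately show "T \<in> D n" by (simp add: D_def)
  qed
  \<comment> \<open>As a closed subset of a complete space, \<open>A\<close> is a Baire space. If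
    all the closed sets \<open>D n\<close> had empty interior in \<open>A\<close>, so would their
    union \<open>A\<close>, yet \<open>0 \<in> A\<close>.\<close>
  have "\<exists>n. ?X interior_of (D n) \<noteq> {}"
  proof (rule ccontr)
    assume "\<not> ?thesis"
    then have int_D: "?X interior_of (D n) = {}" for n by blast
    have "completely_metrizable_space ?X"
      using completely_metrizable_space_closedin[OF completely_metrizable_space_euclidean] A(2)
      by (simp flip: closed_closedin)
    moreover have "closedin ?X (D n)" for n
      by (rule closed_subset[OF _ closed_D]) (auto simp: D_def)
    ultimately have "?X interior_of \<Union>(range D) = {}"
      using int_D by (intro Baire_category_alt) auto
    moreover have "\<Union>(range D) = A"
      using defect by (auto simp: D_def)
    ultimately show False
      using A(3) interior_of_topspace[of ?X] by auto
  qed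
  then obtain n T0 where "T0 \<in> ?X interior_of (D n)" by blast
  then obtain U where U: "openin ?X U" "T0 \<in> U" "U \<subseteq> D n"
    by (auto simp: interior_of_def)
  then obtain r where r: "0 < r" "\<And>S. S \<in> A \<Longrightarrow> dist S T0 < r \<Longrightarrow> S \<in> U"
    unfolding openin_euclidean_subtopology_iff by blast
  have T0: "T0 \<in> A" "defect_le s Y n T0"
    using U(2,3) by (auto simp: D_def)
  have "defect_le s Y (n + n) T" if T: "T \<in> A" for T
  proof -
    \<comment> \<open>The summand \<open>1\<close> keeps the denominator positive for
      \<open>T = 0\<close>; the factor \<open>t\<close> keeps \<open>T0 + t *\<^sub>R T\<close>
      within distance \<open>r\<close> of \<open>T0\<close>.\<close>
    define t where "t = r / (norm T + 1) / 2"
    have t: "0 < t" "t * norm T < r"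
    proof -
      show "0 < t" using r(1) by (simp add: t_def add_nonneg_pos)
      have "t * norm T \<le> t * (norm T + 1)" using \<open>0 < t\<close> by simp
      also have "\<dots> = r / 2"
        using norm_ge_zero[of T] by (simp add: t_def field_simps add_nonneg_eq_0_iff)
      finally show "t * norm T < r" using r(1) by simp
    qed
    have scale_of_real_op: "scale_operator s (of_real u) R = u *\<^sub>R R" for u R
      by (rule blinfun_eqI) (simp add: scale_operator_apply scale_of_real blinfun.scaleR_left)
    have "T0 + t *\<^sub>R T \<in> A"
      using A(4)[OF T0(1) A(5)[OF T, of "of_real t"]] by (simp add: scale_of_real_op)
    moreover have "dist (T0 + t *\<^sub>R T) T0 < r"
      using t by (simp add: dist_norm)
    ultimately have "defect_le s Y n (T0 + t *\<^sub>R T)"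
      using r(2) U(3) by (auto simp: D_def)
    then have "defect_le s Y (n + n) (t *\<^sub>R T)"
      using defect_le_diff[OF Y(1) _ T0(2), of n "T0 + t *\<^sub>R T"] by simp
    then show ?thesis
      using defect_le_scale[OF Y(1), of "n + n" "t *\<^sub>R T" "of_real (inverse t)"] t(1)
      by (simp only: scale_of_real_op) simp
  qed
  then show thesis by (rule that)
qed

end

theorem corollary3p2:
  fixes s :: "'k::{real_normed_field, euclidean_space} \<Rightarrow> 'a::banach \<Rightarrow> 'a"
    and A :: "('a \<Rightarrow>\<^sub>L 'a) set"
    and Y :: "'a set"
  assumes "banach_space s"
    and "operator_algebra s A"
    and "closed A"
    and "half_space s Y"
  shows "(\<forall>T\<in>A. almost_invariant s Y T) \<longleftrightarrow>
         (\<forall>T\<in>weak_operator_topology s closure_of A. almost_invariant s Y T)"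
proof
  interpret banach_space s by fact
  have A: "A \<subseteq> bounded_operators s" "0 \<in> A" "\<And>S T. S \<in> A \<Longrightarrow> T \<in> A \<Longrightarrow> S + T \<in> A"
    "\<And>c T. T \<in> A \<Longrightarrow> scale_operator s c T \<in> A"
    using \<open>operator_algebra s A\<close> by (auto simp: operator_algebra_def)
  have Y: "module.subspace s Y" "closed Y"
    using \<open>half_space s Y\<close> by (auto simp: half_space_def)
  {
    assume "\<forall>T\<in>A. almost_invariant s Y T"
    then have "\<And>T. T \<in> A \<Longrightarrow> \<exists>n. defect_le s Y n T"
      by (simp add: almost_invariant_iff_defect_le)
    \<comment> \<open>One bound for all of \<open>A\<close> is essential: passing to the weak
      closure preserves a fixed defect bound, not mere finiteness of the defect.\<close>
    then obtain N where "\<And>T. T \<in> A \<Longrightarrow> defect_le s Y N T"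
      using uniform_defect[OF Y A(1) \<open>closed A\<close> A(2-4)] by blast
    then show "\<forall>T\<in>weak_operator_topology s closure_of A. almost_invariant s Y T"
      using defect_le_closure_of[OF Y] almost_invariant_iff_defect_le by blast
  }
  have "A \<subseteq> weak_operator_topology s closure_of A"
    using A(1) by (intro closure_of_subset) (simp add: topspace_weak_operator_topology)
  then show "\<forall>T\<in>A. almost_invariant s Y T"
    if "\<forall>T\<in>weak_operator_topology s closure_of A. almost_invariant s Y T"
    using that by blast
qed

end
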